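(* Let $\gamma=e^{2\pi i/3}$, let $\mathscr{D}$ be a mixed graph, let $B=B^\gamma(\mathscr{D})$ be its $\gamma$-incidence matrix and let $D=\operatorname{diag}((\deg(v))_{v\in V(\mathscr{D})})$. Then (i) $B^\ast B = H_\gamma(L_\gamma(\mathscr{D})) + 2I$, (ii) $B B^\ast = H_\gamma(\mathscr{D}) + D$.
   Context: A mixed graph is obtained from a finite simple undirected graph by orienting some (possibly none or all) of its edges into arcs; the unoriented edges are called digons. $\Gamma(\mathscr{D})$ denotes the underlying undirected graph of $\mathscr{D}$; a mixed orientation of an undirected graph $\mathscr{G}$ is a mixed graph with underlying graph $\mathscr{G}$. $\deg(v)$ is the degree of $v$ in $\Gamma(\mathscr{D})$. The edges of $\mathscr{D}$ (arcs and digons) correspond to the edges of $\Gamma(\mathscr{D})$. $M^\ast$ denotes the conjugate transpose. $\gamma$-Hermitian adjacency matrix $H_\gamma(\mathscr{D})$: the entry at $(u,v)$ is $1$ if $uv$ is a digon, $\gamma$ if there is an arc from $u$ to $v$, $\overline\gamma$ if there is an arc from $v$ to $u$, and $0$ otherwise. $\gamma$-incidence matrix $B^\gamma(\mathscr{D})$ (rows indexed by vertices, columns by edges): the entry at $(u,e)$ is $1$ if $e$ is a digon incident with $u$, $\gamma$ if $e$ is an arc with head $u$, $\overline\gamma$ if $e$ is an arc with tail $u$, and $0$ otherwise. $\gamma$-line graph $L_\gamma(\mathscr{D})$: the mixed orientation of the ordinary undirected line graph $L(\Gamma(\mathscr{D}))$ (vertices are the edges of $\mathscr{D}$, two being adjacent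 iff they share an endpoint) given as follows. For distinct edges $e,f$ sharing a vertex $v$: if $e$ is an arc with head $v$ and $f$ is an arc with tail $v$, there is an arc from $e$ to $f$; if $e,f$ are both arcs with head $v$, or both arcs with tail $v$, or both digons, then $ef$ is a digon; if $e$ is an arc with head $v$ and $f$ is a digon, there is an arc from $f$ to $e$; if $e$ is an arc with tail $v$ and $f$ is a digon, there is an arc from $e$ to $f$. *)

theory Defs
  imports Complex_Main "Jordan_Normal_Form.Schur_Decomposition"
begin

record 'a ugraph =
  verts :: "'a set"
  edges :: "'a set set"

definition simple_graph :: "'a ugraph \<Rightarrow> bool" where
  "simple_graph G \<longleftrightarrow> finite (verts G) \<and> (\<forall>e\<in>edges G. e \<subseteq> verts G \<and> card e = 2)"

definition degree :: "'a ugraph \<Rightarrow> 'a \<Rightarrow> nat" where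
  "degree G v = card {e \<in> edges G. v \<in> e}"

definition line_graph :: "'a ugraph \<Rightarrow> 'a set ugraph" where
  "line_graph G =
     \<lparr>verts = edges G,
      edges = {{e, f} | e f. e \<in> edges G \<and> f \<in> edges G \<and> e \<noteq> f \<and> e \<inter> f \<noteq> {}}\<rparr>"

text \<open>A mixed graph is a simple graph some of whose edges carry an orientation. The field
  \<open>edges\<close> contains all edges of the underlying graph, oriented or not, so that
  an edge of the mixed graph is identified with its set of endpoints; \<open>(u, v)\<close>
  in \<open>arcs\<close> means that the edge \<open>{u, v}\<close> is oriented from tail \<open>u\<close> to head \<open>v\<close>.\<close>

record 'a mgraph = "'a ugraph" +
  arcs :: "('a \<times> 'a) set"

definition underlying :: "'a mgraph \<Rightarrow> 'a ugraph" where
  "underlying D = \<lparr>verts = verts D, edges = edges D\<rparr>"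

definition mixed_graph :: "'a mgraph \<Rightarrow> bool" where
  "mixed_graph D \<longleftrightarrow> simple_graph (underlying D) \<and>
     (\<forall>u v. (u, v) \<in> arcs D \<longrightarrow> {u, v} \<in> edges D \<and> (v, u) \<notin> arcs D)"

definition is_digon :: "'a mgraph \<Rightarrow> 'a set \<Rightarrow> bool" where
  "is_digon D e \<longleftrightarrow> e \<in> edges D \<and> (\<forall>u v. (u, v) \<in> arcs D \<longrightarrow> e \<noteq> {u, v})"

definition arc_with_head :: "'a mgraph \<Rightarrow> 'a set \<Rightarrow> 'a \<Rightarrow> bool" where
  "arc_with_head D e v \<longleftrightarrow> (\<exists>u. (u, v) \<in> arcs D \<and> e = {u, v})"

definition arc_with_tail :: "'a mgraph \<Rightarrow> 'a set \<Rightarrow> 'a \<Rightarrow> bool" where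
  "arc_with_tail D e v \<longleftrightarrow> (\<exists>w. (v, w) \<in> arcs D \<and> e = {v, w})"

text \<open>Only the arcs of the \<open>\<gamma>\<close>-line graph are listed; the remaining edges
  of the line graph are its digons (see \<open>is_digon_gamma_line_graph_iff\<close> below).
  The construction does not depend on the value of \<open>\<gamma>\<close>.\<close>

definition gamma_line_graph :: "'a mgraph \<Rightarrow> 'a set mgraph" where
  "gamma_line_graph D =
     \<lparr>verts = verts (line_graph (underlying D)),
      edges = edges (line_graph (underlying D)),
      arcs = {(e, f). e \<in> edges D \<and> f \<in> edges D \<and> e \<noteq> f \<and>
        (\<exists>v \<in> e \<inter> f.
           arc_with_head D e v \<and> arc_with_tail D f v \<or>
           is_digon D e \<and> arc_with_head D f v \<or>
           arc_with_tail D e v \<and> is_digon D f)}\<rparr>"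

definition hermitian_adj_entry :: "complex \<Rightarrow> 'a mgraph \<Rightarrow> 'a \<Rightarrow> 'a \<Rightarrow> complex" where
  "hermitian_adj_entry \<gamma> D u v =
     (if is_digon D {u, v} then 1
      else if (u, v) \<in> arcs D then \<gamma>
      else if (v, u) \<in> arcs D then cnj \<gamma>
      else 0)"

definition incidence_entry :: "complex \<Rightarrow> 'a mgraph \<Rightarrow> 'a \<Rightarrow> 'a set \<Rightarrow> complex" where
  "incidence_entry \<gamma> D u e =
     (if is_digon D e \<and> u \<in> e then 1
      else if arc_with_head D e u then \<gamma>
      else if arc_with_tail D e u then cnj \<gamma>
      else 0)"

text \<open>Matrices indexed by vertices or edges are taken with respect to an enumeration
  of the index set by a list: \<open>vs\<close> enumerates the vertices, \<open>es\<close> the edges.\<close>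

definition enumerates :: "'b list \<Rightarrow> 'b set \<Rightarrow> bool" where
  "enumerates xs A \<longleftrightarrow> distinct xs \<and> set xs = A"

definition hermitian_adj_mat :: "complex \<Rightarrow> 'a mgraph \<Rightarrow> 'a list \<Rightarrow> complex mat" where
  "hermitian_adj_mat \<gamma> D vs =
     Matrix.mat (length vs) (length vs) (\<lambda>(i, j). hermitian_adj_entry \<gamma> D (vs ! i) (vs ! j))"

definition incidence_mat :: "complex \<Rightarrow> 'a mgraph \<Rightarrow> 'a list \<Rightarrow> 'a set list \<Rightarrow> complex mat" where
  "incidence_mat \<gamma> D vs es =
     Matrix.mat (length vs) (length es) (\<lambda>(i, j). incidence_entry \<gamma> D (vs ! i) (es ! j))"

definition degree_mat :: "'a mgraph \<Rightarrow> 'a list \<Rightarrow> complex mat" where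
  "degree_mat D vs = mat_diag (length vs) (\<lambda>i. of_nat (degree (underlying D) (vs ! i)))"

lemma underlying_gamma_line_graph:
  "underlying (gamma_line_graph D) = line_graph (underlying D)"
  by (simp add: underlying_def gamma_line_graph_def)

lemma edge_cases:
  assumes "e \<in> edges D" "mixed_graph D" "v \<in> e"
  shows "is_digon D e \<and> \<not> arc_with_head D e v \<and> \<not> arc_with_tail D e v \<or>
         \<not> is_digon D e \<and> arc_with_head D e v \<and> \<not> arc_with_tail D e v \<or>
         \<not> is_digon D e \<and> \<not> arc_with_head D e v \<and> arc_with_tail D e v"
  using assms unfolding mixed_graph_def is_digon_def arc_with_head_def arc_with_tail_def
  by (smt (verit) doubleton_eq_iff insert_iff singletonD)

lemma common_vertex_unique:
  assumes "mixed_graph D" "e \<in> edges D" "f \<in> edges D" "e \<noteq> f"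
    "v \<in> e" "v \<in> f" "w \<in> e" "w \<in> f"
  shows "v = w"
proof (rule ccontr)
  assume "v \<noteq> w"
  have "card e = 2" "card f = 2"
    using assms unfolding mixed_graph_def simple_graph_def underlying_def by auto
  then have "e = {v, w}" "f = {v, w}"
    using assms(5-8) \<open>v \<noteq> w\<close> by (auto simp: card_2_iff)
  with assms(4) show False by simp
qed

lemma arc_gamma_line_graph_iff:
  assumes "mixed_graph D" "e \<in> edges D" "f \<in> edges D" "e \<noteq> f" "v \<in> e" "v \<in> f"
  shows "(e, f) \<in> arcs (gamma_line_graph D) \<longleftrightarrow>
           arc_with_head D e v \<and> arc_with_tail D f v \<or>
           is_digon D e \<and> arc_with_head D f v \<or>
           arc_with_tail D e v \<and> is_digon D f"
  using assms common_vertex_unique[OF assms(1-4)]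
  unfolding gamma_line_graph_def by auto

lemma mixed_graph_gamma_line_graph:
  assumes "mixed_graph D"
  shows "mixed_graph (gamma_line_graph D)"
proof -
  have fin: "finite (edges D)"
    using assms unfolding mixed_graph_def simple_graph_def underlying_def
    by (auto intro: finite_subset[of _ "Pow (verts D)"])
  have "simple_graph (line_graph (underlying D))"
    unfolding simple_graph_def
  proof (intro conjI ballI)
    show "finite (verts (line_graph (underlying D)))"
      using fin by (simp add: line_graph_def underlying_def)
  next
    fix x assume "x \<in> edges (line_graph (underlying D))"
    then obtain e f where x: "x = {e, f}" "e \<in> edges D" "f \<in> edges D" "e \<noteq> f"
      by (auto simp: line_graph_def underlying_def)
    then show "x \<subseteq> verts (line_graph (underlying D))"
      by (simp add: line_graph_def underlying_def)
    show "card x = 2"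
      using x(4) x(1) by (auto simp del: insert_iff simp: card_insert_if)
  qed
  moreover have "{e, f} \<in> edges (gamma_line_graph D) \<and> (f, e) \<notin> arcs (gamma_line_graph D)"
    if "(e, f) \<in> arcs (gamma_line_graph D)" for e f
  proof -
    from that obtain v where v: "e \<in> edges D" "f \<in> edges D" "e \<noteq> f" "v \<in> e" "v \<in> f"
      by (auto simp: gamma_line_graph_def)
    have "(f, e) \<notin> arcs (gamma_line_graph D)"
      using that v arc_gamma_line_graph_iff[OF assms, of e f v]
        arc_gamma_line_graph_iff[OF assms, of f e v]
        edge_cases[OF v(1) assms v(4)] edge_cases[OF v(2) assms v(5)] by auto
    moreover have "{e, f} \<in> edges (gamma_line_graph D)"
      using v by (auto simp: gamma_line_graph_def line_graph_def underlying_def)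
    ultimately show ?thesis by simp
  qed
  ultimately show ?thesis
    unfolding mixed_graph_def underlying_gamma_line_graph by blast
qed

lemma is_digon_gamma_line_graph_iff:
  assumes "mixed_graph D" "e \<in> edges D" "f \<in> edges D" "e \<noteq> f" "v \<in> e" "v \<in> f"
  shows "is_digon (gamma_line_graph D) {e, f} \<longleftrightarrow>
           arc_with_head D e v \<and> arc_with_head D f v \<or>
           arc_with_tail D e v \<and> arc_with_tail D f v \<or>
           is_digon D e \<and> is_digon D f"
proof -
  have "{e, f} \<in> edges (gamma_line_graph D)"
    using assms by (auto simp: gamma_line_graph_def line_graph_def underlying_def)
  then have "is_digon (gamma_line_graph D) {e, f} \<longleftrightarrow>
      (e, f) \<notin> arcs (gamma_line_graph D) \<and> (f, e) \<notin> arcs (gamma_line_graph D)"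
    unfolding is_digon_def by (metis doubleton_eq_iff)
  then show ?thesis
    using assms arc_gamma_line_graph_iff[OF assms(1), of e f v]
        arc_gamma_line_graph_iff[OF assms(1), of f e v]
        edge_cases[OF assms(2,1,5)] edge_cases[OF assms(3,1,6)] by auto
qed

end

theory Submission
  imports Defs
begin

text \<open>Two distinct edges share at most one vertex, and two distinct vertices lie on at most one
  common edge, so every off-diagonal entry of either product reduces to a single product of two
  incidence entries. It is evaluated by \<open>\<gamma> * cnj \<gamma> = 1\<close> and
  \<open>(cnj \<gamma>)\<^sup>2 = \<gamma>\<close>; the second identity is what singles out the third roots
  of unity. On the diagonal each incident pair contributes \<open>1\<close>.\<close>

lemma cnj_primitive_cube_root:
  assumes "\<gamma> = exp (2 * of_real pi * \<i> / 3)"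
  shows "\<gamma> * cnj \<gamma> = 1" and "cnj \<gamma> * cnj \<gamma> = \<gamma>"
proof -
  have g: "\<gamma> = cis (2 * pi / 3)"
    by (simp add: assms cis_conv_exp mult_ac)
  show "\<gamma> * cnj \<gamma> = 1"
    by (simp add: g cis_mult cis_cnj)
  have "cnj \<gamma> * cnj \<gamma> = cis (2 * pi / 3 - 2 * pi)"
    by (simp add: g cis_mult cis_cnj)
  also have "\<dots> = \<gamma>"
    by (simp only: g cis_divide[symmetric] cis_2pi div_by_1)
  finally show "cnj \<gamma> * cnj \<gamma> = \<gamma>" .
qed

lemma mixed_graph_edgeD:
  assumes "mixed_graph D" "e \<in> edges D"
  shows "e \<subseteq> verts D" and "card e = 2"
  using assms by (auto simp: mixed_graph_def simple_graph_def underlying_def)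

lemma mixed_graph_finite:
  assumes "mixed_graph D"
  shows "finite (verts D)" and "finite (edges D)"
proof -
  show fin: "finite (verts D)"
    using assms by (simp add: mixed_graph_def simple_graph_def underlying_def)
  show "finite (edges D)"
    by (rule finite_subset[of _ "Pow (verts D)"]) (use fin mixed_graph_edgeD[OF assms] in auto)
qed

text \<open>Dual to \<open>common_vertex_unique\<close>: that lemma isolates a single vertex in a
  sum over vertices, this one a single edge in a sum over edges.\<close>

lemma edge_eq_doubleton:
  assumes "mixed_graph D" "e \<in> edges D" "u \<in> e" "v \<in> e" "u \<noteq> v"
  shows "e = {u, v}"
  using mixed_graph_edgeD(2)[OF assms(1,2)] assms(3-5) by (auto simp: card_2_iff)

lemma arc_with_head_doubleton:
  assumes "u \<noteq> v"
  shows "arc_with_head D {u, v} v \<longleftrightarrow> (u, v) \<in> arcs D"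
  using assms by (auto simp: arc_with_head_def doubleton_eq_iff)

lemma arc_with_tail_doubleton:
  assumes "u \<noteq> v"
  shows "arc_with_tail D {u, v} u \<longleftrightarrow> (u, v) \<in> arcs D"
  using assms by (auto simp: arc_with_tail_def doubleton_eq_iff)

text \<open>An arc contains its head and its tail, so each nonzero branch of the entry forces
  incidence.\<close>

lemma incidence_entry_eq_0:
  assumes "u \<notin> e"
  shows "incidence_entry \<gamma> D u e = 0"
  using assms by (auto simp: incidence_entry_def arc_with_head_def arc_with_tail_def)

text \<open>By \<open>edge_cases\<close> the entry at an incident pair is 1, \<gamma> or
  \<open>cnj \<gamma>\<close>, all of modulus 1. Both diagonals thereby become counts.\<close>

lemma incidence_entry_mult_cnj:
  assumes "\<gamma> * cnj \<gamma> = 1" "mixed_graph D" "e \<in> edges D"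
  shows "incidence_entry \<gamma> D u e * cnj (incidence_entry \<gamma> D u e) = (if u \<in> e then 1 else 0)"
proof (cases "u \<in> e")
  case True
  then show ?thesis
    using edge_cases[OF assms(3,2) True] assms(1)
    by (auto simp: incidence_entry_def mult.commute)
qed (simp add: incidence_entry_eq_0)

lemma sum_eq_single:
  assumes "finite A" "a \<in> A" "\<And>x. x \<in> A \<Longrightarrow> x \<noteq> a \<Longrightarrow> f x = (0::'b::comm_monoid_add)"
  shows "sum f A = f a"
  using sum.mono_neutral_right[of A "{a}" f] assms by auto

text \<open>The entrywise form of the first identity, summed over the vertex set so that no
  enumeration enters. The 2 on the diagonal is the number of endpoints of an edge.\<close>

lemma sum_incidence_vertices:
  assumes g: "\<gamma> * cnj \<gamma> = 1" "cnj \<gamma> * cnj \<gamma> = \<gamma>"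
    and D: "mixed_graph D" and e: "e \<in> edges D" and f: "f \<in> edges D"
  shows "(\<Sum>v\<in>verts D. cnj (incidence_entry \<gamma> D v e) * incidence_entry \<gamma> D v f) =
    hermitian_adj_entry \<gamma> (gamma_line_graph D) e f + (if e = f then 2 else 0)"
proof (cases "e = f")
  case True
  have "(\<Sum>v\<in>verts D. cnj (incidence_entry \<gamma> D v e) * incidence_entry \<gamma> D v e) =
      (\<Sum>v\<in>verts D. if v \<in> e then 1 else 0)"
    using incidence_entry_mult_cnj[OF g(1) D e] by (simp add: mult.commute)
  also have "\<dots> = of_nat (card e)"
    using mixed_graph_finite(1)[OF D] mixed_graph_edgeD(1)[OF D e]
    by (simp add: sum.If_cases Int_absorb1)
  finally have "(\<Sum>v\<in>verts D. cnj (incidence_entry \<gamma> D v e) * incidence_entry \<gamma> D v e) = 2"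
    using mixed_graph_edgeD(2)[OF D e] by simp
  \<comment> \<open>\<open>{e, e}\<close> collapses to \<open>{e}\<close>, which has too few
    elements to be an edge of the line graph; arcs join distinct edges by definition.\<close>
  moreover have "hermitian_adj_entry \<gamma> (gamma_line_graph D) e e = 0"
    using mixed_graph_edgeD(2)[OF mixed_graph_gamma_line_graph[OF D], of "{e}"]
    by (auto simp: hermitian_adj_entry_def is_digon_def gamma_line_graph_def)
  ultimately show ?thesis
    using True by simp
next
  case ef: False
  have gg: "\<gamma> * \<gamma> = cnj \<gamma>"
    using arg_cong[OF g(2), of cnj] by simp
  show ?thesis
  proof (cases "e \<inter> f = {}")
    case True
    have "cnj (incidence_entry \<gamma> D v e) * incidence_entry \<gamma> D v f = 0" for v
    proof -
      have "v \<notin> e \<or> v \<notin> f"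
        using True by blast
      then show ?thesis
        by (auto simp: incidence_entry_eq_0)
    qed
    moreover have "{e, f} \<notin> edges (gamma_line_graph D)"
      using True by (auto simp: gamma_line_graph_def line_graph_def doubleton_eq_iff)
    moreover have "(e, f) \<notin> arcs (gamma_line_graph D)" "(f, e) \<notin> arcs (gamma_line_graph D)"
      using True by (auto simp: gamma_line_graph_def)
    ultimately show ?thesis
      using ef by (simp add: hermitian_adj_entry_def is_digon_def)
  next
    case False
    then obtain v where v: "v \<in> e" "v \<in> f" by blast
    \<comment> \<open>On the left \<open>v\<close> is bound by the sum; on the right it is the fixed
      common vertex.\<close>
    have "(\<Sum>v\<in>verts D. cnj (incidence_entry \<gamma> D v e) * incidence_entry \<gamma> D v f) =
        cnj (incidence_entry \<gamma> D v e) * incidence_entry \<gamma> D v f"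
    proof (rule sum_eq_single)
      show "finite (verts D)" "v \<in> verts D"
        using mixed_graph_finite(1)[OF D] mixed_graph_edgeD(1)[OF D e] v by auto
      show "cnj (incidence_entry \<gamma> D w e) * incidence_entry \<gamma> D w f = 0" if "w \<noteq> v" for w
      proof -
        have "w \<notin> e \<or> w \<notin> f"
          using common_vertex_unique[OF D e f ef, of v w] v that by blast
        then show ?thesis
          by (auto simp: incidence_entry_eq_0)
      qed
    qed
    also have "\<dots> = hermitian_adj_entry \<gamma> (gamma_line_graph D) e f"
      \<comment> \<open>Nine cases, by the roles of \<open>e\<close> and \<open>f\<close> at
        \<open>v\<close>. Equal roles give 1, and a digon with an arc gives \<gamma> or
        \<open>cnj \<gamma>\<close> directly. Head of \<open>e\<close> and tail of \<open>f\<close>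
        gives \<open>cnj \<gamma> * cnj \<gamma> = \<gamma>\<close>, an arc from \<open>e\<close> to
        \<open>f\<close>; the reverse gives \<open>\<gamma> * \<gamma>\<close>, handled by
        \<open>gg\<close>.\<close>
      using edge_cases[OF e D v(1)] edge_cases[OF f D v(2)]
      by (elim disjE conjE)
        (simp_all add: hermitian_adj_entry_def incidence_entry_def v g gg mult.commute[of "cnj \<gamma>" \<gamma>]
          is_digon_gamma_line_graph_iff[OF D e f ef v]
          arc_gamma_line_graph_iff[OF D e f ef v]
          arc_gamma_line_graph_iff[OF D f e not_sym[OF ef] v(2,1)])
    finally show ?thesis
      using ef by simp
  qed
qed

text \<open>The entrywise form of the second identity. On the diagonal the incident edges are
  counted; off it only the edge \<open>{u, v}\<close> can contribute.\<close>

lemma sum_incidence_edges: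
  assumes g: "\<gamma> * cnj \<gamma> = 1" "cnj \<gamma> * cnj \<gamma> = \<gamma>"
    and D: "mixed_graph D"
  shows "(\<Sum>e\<in>edges D. incidence_entry \<gamma> D u e * cnj (incidence_entry \<gamma> D v e)) =
    hermitian_adj_entry \<gamma> D u v + (if u = v then of_nat (degree (underlying D) u) else 0)"
proof (cases "u = v")
  case True
  have "(\<Sum>e\<in>edges D. incidence_entry \<gamma> D u e * cnj (incidence_entry \<gamma> D u e)) =
      (\<Sum>e\<in>edges D. if u \<in> e then 1 else 0)"
    by (intro sum.cong) (simp_all add: incidence_entry_mult_cnj[OF g(1) D])
  also have "\<dots> = of_nat (degree (underlying D) u)"
    using mixed_graph_finite(2)[OF D]
    by (simp add: sum.If_cases degree_def underlying_def Int_def)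
  finally have "(\<Sum>e\<in>edges D. incidence_entry \<gamma> D u e * cnj (incidence_entry \<gamma> D u e)) =
      of_nat (degree (underlying D) u)" .
  \<comment> \<open>Since \<open>{u, u}\<close> is \<open>{u}\<close>, this rules out a digon from
    \<open>u\<close> to itself as well as a loop arc.\<close>
  moreover have "{u} \<notin> edges D"
    using mixed_graph_edgeD(2)[OF D, of "{u}"] by auto
  then have "hermitian_adj_entry \<gamma> D u u = 0"
    using D by (auto simp: hermitian_adj_entry_def is_digon_def mixed_graph_def)
  ultimately show ?thesis
    using True by simp
next
  case uv: False
  have gg: "\<gamma> * \<gamma> = cnj \<gamma>"
    using arg_cong[OF g(2), of cnj] by simp
  have zero: "incidence_entry \<gamma> D u e * cnj (incidence_entry \<gamma> D v e) = 0"
    if "e \<in> edges D" "e \<noteq> {u, v}" for e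
  proof -
    have "u \<notin> e \<or> v \<notin> e"
      using edge_eq_doubleton[OF D that(1) _ _ uv] that(2) by blast
    then show ?thesis
      by (auto simp: incidence_entry_eq_0)
  qed
  show ?thesis
  proof (cases "{u, v} \<in> edges D")
    case False
    moreover from this have "{v, u} \<notin> edges D"
      by (simp add: insert_commute)
    ultimately have "(u, v) \<notin> arcs D" "(v, u) \<notin> arcs D"
      using D by (auto simp: mixed_graph_def)
    then have "hermitian_adj_entry \<gamma> D u v = 0"
      using False by (simp add: hermitian_adj_entry_def is_digon_def)
    moreover have "(\<Sum>e\<in>edges D. incidence_entry \<gamma> D u e * cnj (incidence_entry \<gamma> D v e)) = 0"
      using False by (intro sum.neutral ballI zero) auto
    ultimately show ?thesis
      using uv by simp
  next
    case True
    \<comment> \<open>Expressing the roles of both endpoints through the same two arc statements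
      makes the case splits at \<open>u\<close> and at \<open>v\<close> comparable.\<close>
    have heads: "arc_with_head D {u, v} v \<longleftrightarrow> (u, v) \<in> arcs D"
        "arc_with_head D {u, v} u \<longleftrightarrow> (v, u) \<in> arcs D"
      using arc_with_head_doubleton[OF uv] arc_with_head_doubleton[OF not_sym[OF uv]]
      by (simp_all add: insert_commute)
    have tails: "arc_with_tail D {u, v} u \<longleftrightarrow> (u, v) \<in> arcs D"
        "arc_with_tail D {u, v} v \<longleftrightarrow> (v, u) \<in> arcs D"
      using arc_with_tail_doubleton[OF uv] arc_with_tail_doubleton[OF not_sym[OF uv]]
      by (simp_all add: insert_commute)
    have "(\<Sum>e\<in>edges D. incidence_entry \<gamma> D u e * cnj (incidence_entry \<gamma> D v e)) =
        incidence_entry \<gamma> D u {u, v} * cnj (incidence_entry \<gamma> D v {u, v})"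
      using mixed_graph_finite(2)[OF D] True zero by (rule sum_eq_single)
    also have "\<dots> = hermitian_adj_entry \<gamma> D u v"
      \<comment> \<open>The second \<open>simplified\<close> discharges membership in
        \<open>{u, v}\<close>. Of the nine combinations only three are consistent: a digon, an arc
        from \<open>u\<close> to \<open>v\<close>, an arc from \<open>v\<close> to
        \<open>u\<close>.\<close>
      using edge_cases[OF True D, of u, simplified heads tails, simplified]
        edge_cases[OF True D, of v, simplified heads tails, simplified]
      by (elim disjE conjE)
        (simp_all add: hermitian_adj_entry_def incidence_entry_def heads tails g gg)
    finally show ?thesis
      using uv by simp
  qed
qed

text \<open>Distinctness prevents repeated terms. This links matrix products, which sum over
  positions, to the entry lemmas, which sum over sets.\<close>

lemma sum_nth_enumerates:
  assumes "enumerates xs A"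
  shows "(\<Sum>i = 0..<length xs. f (xs ! i)) = sum f A"
  using assms sum.distinct_set_conv_list[of xs f]
  by (simp add: enumerates_def sum_list_sum_nth)

lemma index_mat_adjoint:
  assumes "i < dim_col A" "j < dim_row A"
  shows "mat_adjoint A $$ (i, j) = conjugate (A $$ (j, i))"
  using assms by (simp add: mat_adjoint_def mat_of_rows_def)

theorem theorem8:
  fixes D :: "'a mgraph" and \<gamma> :: complex
    and vs :: "'a list" and es :: "'a set list" and B :: "complex mat"
  assumes "\<gamma> = exp (2 * of_real pi * \<i> / 3)"
    and "mixed_graph D"
    and "enumerates vs (verts D)"
    and "enumerates es (edges D)"
    and "B = incidence_mat \<gamma> D vs es"
  shows "mat_adjoint B * B =
           hermitian_adj_mat \<gamma> (gamma_line_graph D) es + 2 \<cdot>\<^sub>m 1\<^sub>m (length es) \<and>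
         B * mat_adjoint B = hermitian_adj_mat \<gamma> D vs + degree_mat D vs"
proof
  note g = cnj_primitive_cube_root[OF assms(1)]
  have dim [simp]: "dim_row B = length vs" "dim_col B = length es"
    by (simp_all add: assms(5) incidence_mat_def)
  have dim_adj [simp]: "dim_row (mat_adjoint B) = length es" "dim_col (mat_adjoint B) = length vs"
    by (simp_all add: mat_adjoint_def)
  have B: "B $$ (i, j) = incidence_entry \<gamma> D (vs ! i) (es ! j)"
    if "i < length vs" "j < length es" for i j
    using that by (simp add: assms(5) incidence_mat_def)
  have adj: "mat_adjoint B $$ (j, i) = cnj (incidence_entry \<gamma> D (vs ! i) (es ! j))"
    if "i < length vs" "j < length es" for i j
    using that by (simp add: index_mat_adjoint B)
  show "mat_adjoint B * B =
      hermitian_adj_mat \<gamma> (gamma_line_graph D) es + 2 \<cdot>\<^sub>m 1\<^sub>m (length es)" (is "_ = ?R")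
  proof (rule eq_matI)
    fix i j assume "i < dim_row ?R" "j < dim_col ?R"
    then have ij: "i < length es" "j < length es" by simp_all
    then have in_edges: "es ! i \<in> edges D" "es ! j \<in> edges D"
      using assms(4) by (metis enumerates_def nth_mem)+
    \<comment> \<open>The entry lemma tests equality of edges, the identity matrix equality of
      indices; distinctness of \<open>es\<close> makes these agree.\<close>
    have inj: "es ! i = es ! j \<longleftrightarrow> i = j"
      using assms(4) ij by (simp add: enumerates_def nth_eq_iff_index_eq)
    have "(mat_adjoint B * B) $$ (i, j) = (\<Sum>k = 0..<length vs.
        cnj (incidence_entry \<gamma> D (vs ! k) (es ! i)) * incidence_entry \<gamma> D (vs ! k) (es ! j))"
      using ij by (simp add: scalar_prod_def adj B)
    also have "\<dots> = (\<Sum>v\<in>verts D.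
        cnj (incidence_entry \<gamma> D v (es ! i)) * incidence_entry \<gamma> D v (es ! j))"
      by (rule sum_nth_enumerates[OF assms(3)])
    also have "\<dots> = ?R $$ (i, j)"
      using ij by (simp add: sum_incidence_vertices[OF g assms(2) in_edges] inj hermitian_adj_mat_def)
    finally show "(mat_adjoint B * B) $$ (i, j) = ?R $$ (i, j)" .
  qed (simp_all add: hermitian_adj_mat_def)
  show "B * mat_adjoint B = hermitian_adj_mat \<gamma> D vs + degree_mat D vs" (is "_ = ?R")
  proof (rule eq_matI)
    fix i j assume "i < dim_row ?R" "j < dim_col ?R"
    then have ij: "i < length vs" "j < length vs" by (simp_all add: degree_mat_def mat_diag_def)
    then have inj: "vs ! i = vs ! j \<longleftrightarrow> i = j"
      using assms(3) by (simp add: enumerates_def nth_eq_iff_index_eq)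
    have "(B * mat_adjoint B) $$ (i, j) = (\<Sum>k = 0..<length es.
        incidence_entry \<gamma> D (vs ! i) (es ! k) * cnj (incidence_entry \<gamma> D (vs ! j) (es ! k)))"
      using ij by (simp add: scalar_prod_def adj B)
    also have "\<dots> = (\<Sum>e\<in>edges D.
        incidence_entry \<gamma> D (vs ! i) e * cnj (incidence_entry \<gamma> D (vs ! j) e))"
      by (rule sum_nth_enumerates[OF assms(4)])
    also have "\<dots> = ?R $$ (i, j)"
      using ij by (simp add: sum_incidence_edges[OF g assms(2)] inj hermitian_adj_mat_def
          degree_mat_def mat_diag_def)
    finally show "(B * mat_adjoint B) $$ (i, j) = ?R $$ (i, j)" .
  qed (simp_all add: hermitian_adj_mat_def degree_mat_def mat_diag_def)
qed

end
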